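(* Let $S$ be a countable semigroup, and let $\widehat{\mathbb{C}S}$ denote the Arens-Michael envelope of its semigroup algebra $\mathbb{C}S$. Then the locally convex space $\widehat{\mathbb{C}S}$ is nuclear.
   Context: For a semigroup $S$ (not necessarily having an identity), $\mathbb{C}S$ is its semigroup algebra over $\mathbb{C}$: the complex vector space with basis $\{\delta_s : s\in S\}$ and multiplication determined by $\delta_s\delta_t=\delta_{st}$. Algebras are associative and not necessarily unital. A submultiplicative prenorm on an algebra is a seminorm $\|\cdot\|$ with $\|ab\|\le\|a\|\,\|b\|$ for all elements $a,b$. The Arens-Michael envelope of an associative algebra $A$ over $\mathbb{C}$ is the (Hausdorff) completion of $A$ with respect to the topology determined by all possible submultiplicative prenorms on $A$. The Arens-Michael envelope of $\mathbb{C}S$ is denoted by $\widehat{\mathbb{C}S}$. *)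

theory Defs
  imports "HOL-Analysis.Analysis" "HOL-Library.Poly_Mapping" "HOL-Library.Function_Algebras"
begin

section \<open>The semigroup algebra\<close>

text \<open>
  The underlying vector space of the semigroup algebra of \<open>'s\<close> is the type
  \<open>'s \<Rightarrow>\<^sub>0 complex\<close> of finitely supported functions; the basis vector at \<open>s\<close> is
  \<open>Poly_Mapping.single s 1\<close>.  The library's product on this type is the convolution for an
  additively written monoid, so the product for a semigroup is defined here.
\<close>

definition sgalg_scale :: "complex \<Rightarrow> ('s \<Rightarrow>\<^sub>0 complex) \<Rightarrow> ('s \<Rightarrow>\<^sub>0 complex)" where
  "sgalg_scale c a = Poly_Mapping.map ((*) c) a"

definition sgalg_mult ::
    "('s::semigroup_mult \<Rightarrow>\<^sub>0 complex) \<Rightarrow> ('s \<Rightarrow>\<^sub>0 complex) \<Rightarrow> ('s \<Rightarrow>\<^sub>0 complex)" where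
  "sgalg_mult a b =
     (\<Sum>s\<in>Poly_Mapping.keys a. \<Sum>t\<in>Poly_Mapping.keys b.
        Poly_Mapping.single (s * t) (Poly_Mapping.lookup a s * Poly_Mapping.lookup b t))"

lemma lookup_sgalg_scale [simp]:
  "Poly_Mapping.lookup (sgalg_scale c a) s = c * Poly_Mapping.lookup a s"
  unfolding sgalg_scale_def by transfer (auto simp: when_def)

lemma vector_space_sgalg_scale: "vector_space sgalg_scale"
  by unfold_locales
     (auto intro!: poly_mapping_eqI simp: lookup_add algebra_simps)

lemma sgalg_mult_single:
  "sgalg_mult (Poly_Mapping.single s x) (Poly_Mapping.single t y) =
   Poly_Mapping.single (s * t) (x * y)"
  by (cases "x = 0"; cases "y = 0") (simp_all add: sgalg_mult_def)

lemma sgalg_mult_superset: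
  assumes "finite A" "Poly_Mapping.keys a \<subseteq> A" "finite B" "Poly_Mapping.keys b \<subseteq> B"
  shows "sgalg_mult a b =
     (\<Sum>s\<in>A. \<Sum>t\<in>B.
        Poly_Mapping.single (s * t) (Poly_Mapping.lookup a s * Poly_Mapping.lookup b t))"
proof -
  have inner: "(\<Sum>t\<in>Poly_Mapping.keys b.
        Poly_Mapping.single (s * t) (Poly_Mapping.lookup a s * Poly_Mapping.lookup b t)) =
      (\<Sum>t\<in>B. Poly_Mapping.single (s * t) (Poly_Mapping.lookup a s * Poly_Mapping.lookup b t))"
    for s
    using assms(3,4) by (intro sum.mono_neutral_left) (auto simp: in_keys_iff)
  show ?thesis
    unfolding sgalg_mult_def inner
    using assms(1,2) by (intro sum.mono_neutral_left) (auto simp: in_keys_iff)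
qed

lemma sgalg_mult_add_left: "sgalg_mult (a + b) c = sgalg_mult a c + sgalg_mult b c"
proof -
  let ?A = "Poly_Mapping.keys a \<union> Poly_Mapping.keys b" and ?C = "Poly_Mapping.keys c"
  have "Poly_Mapping.keys (a + b) \<subseteq> ?A" by (rule Poly_Mapping.keys_add)
  then show ?thesis
    by (simp add: sgalg_mult_superset[of ?A _ ?C] lookup_add distrib_right single_add sum.distrib)
qed

lemma sgalg_mult_add_right: "sgalg_mult a (b + c) = sgalg_mult a b + sgalg_mult a c"
proof -
  let ?A = "Poly_Mapping.keys b \<union> Poly_Mapping.keys c" and ?C = "Poly_Mapping.keys a"
  have "Poly_Mapping.keys (b + c) \<subseteq> ?A" by (rule Poly_Mapping.keys_add)
  then show ?thesis
    by (simp add: sgalg_mult_superset[of ?C _ ?A] lookup_add distrib_left single_add sum.distrib)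
qed

lemma sgalg_mult_scale_left: "sgalg_mult (sgalg_scale x a) b = sgalg_scale x (sgalg_mult a b)"
proof -
  interpret vector_space sgalg_scale by (rule vector_space_sgalg_scale)
  have single: "sgalg_scale x (Poly_Mapping.single s y) = Poly_Mapping.single s (x * y)" for s y
    by (rule poly_mapping_eqI) (simp add: lookup_single when_def)
  have "Poly_Mapping.keys (sgalg_scale x a) \<subseteq> Poly_Mapping.keys a"
    by (auto simp: in_keys_iff)
  then show ?thesis
    by (simp add: sgalg_mult_superset[of "Poly_Mapping.keys a" _ "Poly_Mapping.keys b"]
        scale_sum_right single mult.assoc)
qed

lemma sgalg_mult_scale_right: "sgalg_mult a (sgalg_scale x b) = sgalg_scale x (sgalg_mult a b)"
proof -
  interpret vector_space sgalg_scale by (rule vector_space_sgalg_scale)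
  have single: "sgalg_scale x (Poly_Mapping.single s y) = Poly_Mapping.single s (x * y)" for s y
    by (rule poly_mapping_eqI) (simp add: lookup_single when_def)
  have "Poly_Mapping.keys (sgalg_scale x b) \<subseteq> Poly_Mapping.keys b"
    by (auto simp: in_keys_iff)
  then show ?thesis
    by (simp add: sgalg_mult_superset[of "Poly_Mapping.keys a" _ "Poly_Mapping.keys b"]
        scale_sum_right single mult.left_commute)
qed

lemma sgalg_mult_zero [simp]: "sgalg_mult 0 a = 0" "sgalg_mult a 0 = 0"
  by (simp_all add: sgalg_mult_def)

lemma sgalg_mult_sum_left: "sgalg_mult (\<Sum>i\<in>I. f i) a = (\<Sum>i\<in>I. sgalg_mult (f i) a)"
  by (induction I rule: infinite_finite_induct) (simp_all add: sgalg_mult_add_left)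

lemma sgalg_mult_sum_right: "sgalg_mult a (\<Sum>i\<in>I. f i) = (\<Sum>i\<in>I. sgalg_mult a (f i))"
  by (induction I rule: infinite_finite_induct) (simp_all add: sgalg_mult_add_right)

lemma sgalg_expand:
  "a = (\<Sum>s\<in>Poly_Mapping.keys a. Poly_Mapping.single s (Poly_Mapping.lookup a s))"
  by (rule poly_mapping_eqI) (auto simp: lookup_sum lookup_single when_def in_keys_iff)

lemma sgalg_mult_assoc: "sgalg_mult (sgalg_mult a b) c = sgalg_mult a (sgalg_mult b c)"
  by (subst (1 2) sgalg_expand[of a], subst (1 2) sgalg_expand[of b],
      subst (1 2) sgalg_expand[of c])
     (simp add: sgalg_mult_sum_left sgalg_mult_sum_right sgalg_mult_single mult.assoc)


section \<open>Seminorms and locally convex spaces\<close>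

definition seminorm :: "(complex \<Rightarrow> 'v \<Rightarrow> 'v) \<Rightarrow> ('v::ab_group_add \<Rightarrow> real) \<Rightarrow> bool" where
  "seminorm sc p \<longleftrightarrow>
     (\<forall>x y. p (x + y) \<le> p x + p y) \<and> (\<forall>c x. p (sc c x) = cmod c * p x)"

definition submultiplicative_prenorm ::
    "(complex \<Rightarrow> 'v \<Rightarrow> 'v) \<Rightarrow> ('v \<Rightarrow> 'v \<Rightarrow> 'v) \<Rightarrow> ('v::ab_group_add \<Rightarrow> real) \<Rightarrow> bool" where
  "submultiplicative_prenorm sc mul p \<longleftrightarrow>
     seminorm sc p \<and> (\<forall>x y. p (mul x y) \<le> p x * p y)"

definition seminorm_topology :: "('v::ab_group_add \<Rightarrow> real) set \<Rightarrow> 'v topology" where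
  "seminorm_topology P = topology_generated_by {{x. p (x - a) < e} | p a e. p \<in> P \<and> e > 0}"

text \<open>
  A topological vector space over the complex numbers is a type of sort
  \<open>{uniform_topological_group_add, ab_group_add}\<close>, whose uniformity is the one induced by the
  group topology, together with a jointly continuous scalar multiplication.
\<close>

definition locally_convex_space ::
    "(complex \<Rightarrow> 'e \<Rightarrow> 'e::{uniform_topological_group_add, ab_group_add}) \<Rightarrow> bool" where
  "locally_convex_space sc \<longleftrightarrow>
     vector_space sc \<and>
     continuous_on UNIV (\<lambda>(c, x). sc c x) \<and>
     (\<forall>U. open U \<and> 0 \<in> U \<longrightarrow>
        (\<exists>V. open V \<and> 0 \<in> V \<and> V \<subseteq> U \<and>
           (\<forall>x\<in>V. \<forall>y\<in>V. \<forall>t\<in>{0..1}.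
              sc (complex_of_real t) x + sc (complex_of_real (1 - t)) y \<in> V)))"


section \<open>Hausdorff completions and Arens-Michael envelopes\<close>

text \<open>
  \<open>\<iota>\<close> exhibits the complete Hausdorff space \<open>'e\<close> as the Hausdorff completion of \<open>'v\<close> with the
  topology \<open>T\<close>; this determines \<open>'e\<close> together with \<open>\<iota>\<close> up to a unique isomorphism.  As \<open>T\<close> need
  not be Hausdorff, \<open>\<iota>\<close> need not be injective: \<open>T\<close> is the initial topology along \<open>\<iota>\<close>.
\<close>

definition hausdorff_completion ::
    "(complex \<Rightarrow> 'v \<Rightarrow> 'v::ab_group_add) \<Rightarrow> 'v topology \<Rightarrow>
     (complex \<Rightarrow> 'e \<Rightarrow> 'e::{uniform_topological_group_add, ab_group_add, t2_space}) \<Rightarrow>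
     ('v \<Rightarrow> 'e) \<Rightarrow> bool" where
  "hausdorff_completion scaleV T scaleE \<iota> \<longleftrightarrow>
     locally_convex_space scaleE \<and>
     complete (UNIV :: 'e set) \<and>
     Vector_Spaces.linear scaleV scaleE \<iota> \<and>
     closure (range \<iota>) = UNIV \<and>
     T = pullback_topology UNIV \<iota> euclidean"

definition arens_michael_envelope ::
    "(complex \<Rightarrow> 'v \<Rightarrow> 'v::ab_group_add) \<Rightarrow> ('v \<Rightarrow> 'v \<Rightarrow> 'v) \<Rightarrow>
     (complex \<Rightarrow> 'e \<Rightarrow> 'e::{uniform_topological_group_add, ab_group_add, t2_space}) \<Rightarrow>
     ('v \<Rightarrow> 'e) \<Rightarrow> bool" where
  "arens_michael_envelope scaleV mul scaleE \<iota> \<longleftrightarrow>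
     hausdorff_completion scaleV
       (seminorm_topology {p. submultiplicative_prenorm scaleV mul p}) scaleE \<iota>"


section \<open>Nuclear spaces\<close>

text \<open>
  The completion of \<open>'e\<close> with respect to a seminorm \<open>p\<close> is presented by the space of \<open>p\<close>-Cauchy
  sequences with the seminorm \<open>completion_seminorm p\<close>.  The quotient of this complete seminormed
  space by the null sequences is the Banach space associated with \<open>p\<close>.  The quotient is never
  formed: bounded functionals vanish on null sequences, and equalities in the quotient are
  expressed by the seminorm.
\<close>

definition seminorm_Cauchy :: "('e::ab_group_add \<Rightarrow> real) \<Rightarrow> (nat \<Rightarrow> 'e) set" where
  "seminorm_Cauchy p = {u. \<forall>e>0. \<exists>N. \<forall>m\<ge>N. \<forall>n\<ge>N. p (u m - u n) < e}"

definition completion_seminorm :: "('e \<Rightarrow> real) \<Rightarrow> (nat \<Rightarrow> 'e) \<Rightarrow> real" where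
  "completion_seminorm p u = lim (\<lambda>k. p (u k))"

definition seq_scale :: "(complex \<Rightarrow> 'e \<Rightarrow> 'e) \<Rightarrow> complex \<Rightarrow> (nat \<Rightarrow> 'e) \<Rightarrow> (nat \<Rightarrow> 'e)" where
  "seq_scale sc c u = (\<lambda>k. sc c (u k))"

text \<open>
  \<open>T\<close> is a nuclear map from the seminormed space \<open>X\<close> to the seminormed space \<open>Y\<close>, that is,
  \<open>T x = (\<Sum>n. f n x \<cdot> y n)\<close> with bounded functionals \<open>f n\<close> on \<open>X\<close> and \<open>y n \<in> Y\<close> such that the sum
  of the products of their norms is finite; \<open>C n\<close> is a bound for the norm of \<open>f n\<close>.
\<close>

definition nuclear_map ::
    "(complex \<Rightarrow> 'x \<Rightarrow> 'x) \<Rightarrow> 'x set \<Rightarrow> ('x::ab_group_add \<Rightarrow> real) \<Rightarrow>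
     (complex \<Rightarrow> 'y \<Rightarrow> 'y) \<Rightarrow> 'y set \<Rightarrow> ('y::ab_group_add \<Rightarrow> real) \<Rightarrow> ('x \<Rightarrow> 'y) \<Rightarrow> bool" where
  "nuclear_map scaleX X normX scaleY Y normY T \<longleftrightarrow>
     (\<exists>(f :: nat \<Rightarrow> 'x \<Rightarrow> complex) (y :: nat \<Rightarrow> 'y) (C :: nat \<Rightarrow> real).
        (\<forall>n. \<forall>x\<in>X. \<forall>x'\<in>X. f n (x + x') = f n x + f n x') \<and>
        (\<forall>n c. \<forall>x\<in>X. f n (scaleX c x) = c * f n x) \<and>
        (\<forall>n. C n \<ge> 0 \<and> (\<forall>x\<in>X. cmod (f n x) \<le> C n * normX x)) \<and>
        (\<forall>n. y n \<in> Y) \<and>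
        summable (\<lambda>n. C n * normY (y n)) \<and>
        (\<forall>x\<in>X. (\<lambda>N. normY (T x - (\<Sum>n<N. scaleY (f n x) (y n)))) \<longlonglongrightarrow> 0))"

text \<open>
  For \<open>p \<le> q\<close> every \<open>q\<close>-Cauchy sequence is \<open>p\<close>-Cauchy, so the canonical map between the
  completions is given by the identity on sequences.
\<close>

definition nuclear_space ::
    "(complex \<Rightarrow> 'e \<Rightarrow> 'e::{uniform_topological_group_add, ab_group_add}) \<Rightarrow> bool" where
  "nuclear_space sc \<longleftrightarrow>
     locally_convex_space sc \<and>
     (\<forall>p. seminorm sc p \<and> continuous_on UNIV p \<longrightarrow>
        (\<exists>q. seminorm sc q \<and> continuous_on UNIV q \<and> (\<forall>x. p x \<le> q x) \<and>
           nuclear_map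
             (seq_scale sc) (seminorm_Cauchy q) (completion_seminorm q)
             (seq_scale sc) (seminorm_Cauchy p) (completion_seminorm p)
             (\<lambda>u. u)))"

end

theory Submission
  imports Defs
begin

text \<open>
  Every submultiplicative prenorm \<open>r\<close> is dominated by the \<open>\<ell>\<^sup>1\<close>-norm with the submultiplicative
  weight \<open>r \<delta>\<^sub>s\<close>.  Give the \<open>k\<close>-th element of the semigroup (counted from 1) the cost \<open>k\<close>,
  and let \<open>L s\<close> be the least cost of a factorization of \<open>s\<close>.  Then \<open>L\<close> is subadditive, and at
  most \<open>2\<^sup>n\<close> elements have \<open>L s = n\<close>, since the costs along a word of cost \<open>n\<close> form
  a composition of \<open>n\<close> that determines the word.  Hence \<open>\<phi> s = 4\<^bsup>L s\<^esup>\<close> is submultiplicative and \<open>1 / \<phi>\<close> is summable.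
  The weight \<open>r \<delta>\<^sub>s \<cdot> \<phi> s\<close> is again submultiplicative, so its \<open>\<ell>\<^sup>1\<close>-norm is continuous, and
  the expansion \<open>a = (\<Sum>s. a\<^sub>s \<delta>\<^sub>s)\<close> shows that passing from it to \<open>r\<close> is nuclear.
\<close>

section \<open>Length functions on countable semigroups\<close>

text \<open>Costs start at 1, not 0, so that removing the first letter strictly lowers the remaining
  cost but never to 0; the recursion in \<open>card_word_length\<close> depends on this.\<close>

inductive word_length :: "('s::semigroup_mult \<Rightarrow> nat) \<Rightarrow> nat \<Rightarrow> 's \<Rightarrow> bool" for e where
  letter: "word_length e (Suc (e s)) s"
| Cons: "word_length e n t \<Longrightarrow> word_length e (Suc (e s) + n) (s * t)"

text \<open>Induction along the first factorization, with associativity pulling its first letter to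
  the front. This is what makes the least cost subadditive.\<close>

lemma word_length_mult:
  "word_length e m s \<Longrightarrow> word_length e n t \<Longrightarrow> word_length e (m + n) (s * t)"
proof (induction rule: word_length.induct)
  case (letter s)
  then show ?case by (rule word_length.Cons)
next
  case (Cons m t' s)
  then show ?case
    using word_length.Cons[of e "m + n" "t' * t" s] by (simp add: mult.assoc add.assoc)
qed

text \<open>Since \<open>e\<close> is injective, the cost of a letter determines the letter. An
  element reached at cost \<open>n\<close> is thus one fixed letter, or is determined by a tail of
  some cost \<open>j < n\<close>, and 1 + (2^0 + ... + 2^(n-1)) = 2^n closes the induction.\<close>

lemma card_word_length:
  assumes "inj e"
  shows "finite {s. word_length e n s} \<and> card {s. word_length e n s} \<le> 2 ^ n"
proof (induction n rule: less_induct)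
  case (less n)
  let ?B = "\<lambda>j. (*) (inv e (n - 1 - j)) ` {t. word_length e j t}"
  \<comment> \<open>For \<open>n = 0\<close> there are no words, and the inserted letter is junk
    that the bound 2^0 = 1 absorbs.\<close>
  have sub: "{s. word_length e n s} \<subseteq> insert (inv e (n - 1)) (\<Union>j<n. ?B j)"
  proof
    fix x assume "x \<in> {s. word_length e n s}"
    then have "word_length e n x" by simp
    then show "x \<in> insert (inv e (n - 1)) (\<Union>j<n. ?B j)"
    proof cases
      case letter
      then show ?thesis using assms by simp
    next
      case (Cons j t s)
      then have "j < n" "inv e (n - 1 - j) = s" using assms by simp_all
      then show ?thesis using Cons by blast
    qed
  qed
  have fin: "finite (\<Union>j<n. ?B j)" using less by auto
  have gp: "Suc (\<Sum>j<n. 2 ^ j) = 2 ^ n" by (induction n) simp_all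
  have "card (\<Union>j<n. ?B j) \<le> (\<Sum>j<n. card (?B j))" by (rule card_UN_le) simp
  also have "\<dots> \<le> (\<Sum>j<n. 2 ^ j)"
    by (intro sum_mono) (meson card_image_le lessThan_iff less le_trans)
  finally have le: "Suc (card (\<Union>j<n. ?B j)) \<le> 2 ^ n"
    using gp by linarith
  have "card {s. word_length e n s} \<le> card (insert (inv e (n - 1)) (\<Union>j<n. ?B j))"
    using sub fin by (intro card_mono) auto
  also have "\<dots> \<le> Suc (card (\<Union>j<n. ?B j))" by (rule card_insert_le_m1) simp_all
  finally show ?case using le sub fin by (meson finite.insertI finite_subset le_trans)
qed

lemma summable_submultiplicative_weight:
  assumes "countable (UNIV :: 's::semigroup_mult set)"
  obtains \<phi> :: "'s::semigroup_mult \<Rightarrow> real" where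
    "\<And>s. 1 \<le> \<phi> s" "\<And>s t. \<phi> (s * t) \<le> \<phi> s * \<phi> t"
    "\<And>F. finite F \<Longrightarrow> (\<Sum>s\<in>F. 1 / \<phi> s) \<le> 2"
proof -
  obtain e :: "'s \<Rightarrow> nat" where e: "inj e" using assms by (auto simp: countable_def)
  define L where "L s = (LEAST n. word_length e n s)" for s
  have L: "word_length e (L s) s" for s
    unfolding L_def by (rule LeastI) (rule letter)
  have L_le: "L s \<le> n" if "word_length e n s" for n s
    unfolding L_def using that by (rule Least_le)
  have ge: "1 \<le> (4::real) ^ L s" for s by simp
  have mult: "(4::real) ^ L (s * t) \<le> 4 ^ L s * 4 ^ L t" for s t
    unfolding power_add[symmetric] by (intro power_increasing L_le word_length_mult L) simp
  have "(\<Sum>s\<in>F. 1 / (4::real) ^ L s) \<le> 2" if F: "finite F" for F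
  proof -
    obtain M where M: "L ` F \<subseteq> {..<M}" using F finite_nat_iff_bounded by blast
    \<comment> \<open>Group by cost: at most 2^n elements contribute 4^-n each, so the base 4 beats
      the growth rate 2 and a geometric series with sum 2 remains.\<close>
    have "(\<Sum>s\<in>F. 1 / (4::real) ^ L s) = (\<Sum>n<M. \<Sum>s\<in>{s\<in>F. L s = n}. 1 / 4 ^ L s)"
      by (rule sum.group[symmetric]) (use F M in auto)
    also have "\<dots> = (\<Sum>n<M. card {s\<in>F. L s = n} * (1 / 4 ^ n))"
      by (intro sum.cong) auto
    also have "\<dots> \<le> (\<Sum>n<M. (1 / 2) ^ n)"
    proof (rule sum_mono)
      fix n
      have "card {s\<in>F. L s = n} \<le> card {s. word_length e n s}"
        using card_word_length[OF e, of n] L by (intro card_mono) auto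
      also have "\<dots> \<le> 2 ^ n"
        using card_word_length[OF e, of n] by simp
      finally have "real (card {s\<in>F. L s = n}) \<le> real (2 ^ n)"
        by (rule of_nat_mono)
      then have "real (card {s\<in>F. L s = n}) \<le> 2 ^ n"
        by simp
      then have "real (card {s\<in>F. L s = n}) * (1 / 4 ^ n) \<le> 2 ^ n * (1 / 4 ^ n)"
        by (intro mult_right_mono) auto
      also have "\<dots> = (1 / 2) ^ n"
        by (simp add: power_divide[symmetric])
      finally show "real (card {s\<in>F. L s = n}) * (1 / 4 ^ n) \<le> (1 / 2) ^ n" .
    qed
    also have "\<dots> \<le> 2" by (simp add: sum_gp_strict)
    finally show ?thesis .
  qed
  then show thesis by (rule that[OF ge mult])
qed


section \<open>Seminorms\<close>

text \<open>Nonnegativity is derived from 0 = p 0 \<le> p x + p (- x) = 2 * p x.\<close>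

lemma seminormD:
  assumes "vector_space sc" "seminorm sc p"
  shows seminorm_triangle: "p (x + y) \<le> p x + p y"
    and seminorm_scale: "p (sc c x) = cmod c * p x"
    and seminorm_zero: "p 0 = 0"
    and seminorm_minus: "p (- x) = p x"
    and seminorm_nonneg: "0 \<le> p x"
proof -
  interpret vector_space sc by fact
  show tri: "p (x + y) \<le> p x + p y" and sc: "p (sc c x) = cmod c * p x" for x y c
    using assms(2) by (auto simp: seminorm_def)
  show 0: "p 0 = 0" using sc[of 0 0] by simp
  show m: "p (- x) = p x" for x using sc[of "-1" x] by simp
  show "0 \<le> p x" using tri[of x "- x"] by (simp add: m 0)
qed

lemma seminorm_diff_triangle:
  assumes "vector_space sc" "seminorm sc p"
  shows "p (x - z) \<le> p (x - y) + p (y - z)"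
  using seminorm_triangle[OF assms, of "x - y" "y - z"] by simp

lemma seminorm_abs_diff_le:
  assumes "vector_space sc" "seminorm sc p"
  shows "\<bar>p x - p y\<bar> \<le> p (x - y)"
  using seminorm_triangle[OF assms, of "x - y" y] seminorm_triangle[OF assms, of "y - x" x]
    seminorm_minus[OF assms, of "x - y"] by simp

lemma seminorm_sum_le:
  assumes "vector_space sc" "seminorm sc p"
  shows "p (\<Sum>i\<in>I. f i) \<le> (\<Sum>i\<in>I. p (f i))"
proof (induction I rule: infinite_finite_induct)
  case (insert i I)
  then show ?case using seminorm_triangle[OF assms, of "f i" "sum f I"] by simp
qed (simp_all add: seminorm_zero[OF assms])

section \<open>Completions of seminormed spaces and nuclear maps between them\<close>

lemma seminorm_Cauchy_completion_seminorm:
  assumes "vector_space sc" "seminorm sc p" "u \<in> seminorm_Cauchy p"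
  shows "(\<lambda>k. p (u k)) \<longlonglongrightarrow> completion_seminorm p u"
proof -
  have "Cauchy (\<lambda>k. p (u k))"
  proof (rule metric_CauchyI)
    fix e :: real assume "e > 0"
    then obtain N where "\<forall>m\<ge>N. \<forall>n\<ge>N. p (u m - u n) < e"
      using assms(3) by (auto simp: seminorm_Cauchy_def)
    then show "\<exists>N. \<forall>m\<ge>N. \<forall>n\<ge>N. dist (p (u m)) (p (u n)) < e"
      using seminorm_abs_diff_le[OF assms(1,2)] by (metis dist_real_def le_less_trans)
  qed
  then show ?thesis
    unfolding completion_seminorm_def by (simp add: Cauchy_convergent convergent_LIMSEQ_iff[symmetric])
qed

lemma seminorm_Cauchy_mono:
  assumes "\<And>x. p x \<le> q x" "u \<in> seminorm_Cauchy q"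
  shows "u \<in> seminorm_Cauchy p"
  using assms unfolding seminorm_Cauchy_def by (blast intro: le_less_trans)

lemma seminorm_Cauchy_minus_const:
  "u \<in> seminorm_Cauchy p \<Longrightarrow> (\<lambda>k. u k - c) \<in> seminorm_Cauchy p"
  by (simp add: seminorm_Cauchy_def)

text \<open>An expansion on a \<open>q\<close>-dense set suffices. The functionals extend to Cauchy
  sequences by limits because they are \<open>q\<close>-bounded, and the vectors enter as constant
  sequences. Finiteness of the sum of \<open>C n * p (y n)\<close> bounds all partial sums uniformly
  as maps from \<open>q\<close> to \<open>p\<close>, so convergence on \<open>D\<close> passes to
  limits.\<close>

lemma nuclear_map_seminorm_completions:
  fixes sc :: "complex \<Rightarrow> 'e \<Rightarrow> 'e::ab_group_add"
  assumes vs: "vector_space sc" and p: "seminorm sc p" and q: "seminorm sc q"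
    and le: "\<And>x. p x \<le> q x"
    and dense: "\<And>x e. e > 0 \<Longrightarrow> \<exists>a\<in>D. q (x - a) < e"
    and g_add: "\<And>n x y. g n (x + y) = g n x + g n y"
    and g_scale: "\<And>n c x. g n (sc c x) = c * g n x"
    and g_le: "\<And>n x. cmod (g n x) \<le> C n * q x"
    and C: "\<And>n. 0 \<le> C n"
    and summable: "summable (\<lambda>n. C n * p (y n))"
    and expansion: "\<And>a. a \<in> D \<Longrightarrow> (\<lambda>N. p (a - (\<Sum>n<N. sc (g n a) (y n)))) \<longlonglongrightarrow> 0"
  shows "nuclear_map (seq_scale sc) (seminorm_Cauchy q) (completion_seminorm q)
           (seq_scale sc) (seminorm_Cauchy p) (completion_seminorm p) (\<lambda>u. u)"
proof -
  interpret vector_space sc by fact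
  note lim_q = seminorm_Cauchy_completion_seminorm[OF vs q]
  note lim_p = seminorm_Cauchy_completion_seminorm[OF vs p]
  have g_diff: "g n (x - z) = g n x - g n z" for n x z
    using g_add[of n "x - z" z] by simp
  define f where "f n u = lim (\<lambda>k. g n (u k))" for n and u :: "nat \<Rightarrow> 'e"
  have f: "(\<lambda>k. g n (u k)) \<longlonglongrightarrow> f n u" if u: "u \<in> seminorm_Cauchy q" for n u
  proof -
    have "Cauchy (\<lambda>k. g n (u k))"
    proof (rule metric_CauchyI)
      fix e :: real assume e: "e > 0"
      \<comment> \<open>\<open>C n\<close> may be 0, hence the divisor
        \<open>C n + 1\<close>.\<close>
      have C1: "C n + 1 > 0" using C[of n] by simp
      obtain N where N: "\<forall>i\<ge>N. \<forall>j\<ge>N. q (u i - u j) < e / (C n + 1)"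
        using u e C1 by (force simp: seminorm_Cauchy_def)
      have "dist (g n (u i)) (g n (u j)) < e" if ij: "i \<ge> N" "j \<ge> N" for i j
      proof -
        have "dist (g n (u i)) (g n (u j)) \<le> C n * q (u i - u j)"
          using g_le[of n "u i - u j"] by (simp add: g_diff dist_norm)
        also have "\<dots> \<le> (C n + 1) * q (u i - u j)"
          by (simp add: algebra_simps seminorm_nonneg[OF vs q])
        also have "\<dots> < e" using N ij C1 by (simp add: pos_less_divide_eq mult.commute)
        finally show ?thesis .
      qed
      then show "\<exists>N. \<forall>i\<ge>N. \<forall>j\<ge>N. dist (g n (u i)) (g n (u j)) < e" by blast
    qed
    then show ?thesis
      unfolding f_def by (simp add: Cauchy_convergent convergent_LIMSEQ_iff[symmetric])
  qed
  have f_add: "f n (u + v) = f n u + f n v" if "u \<in> seminorm_Cauchy q" "v \<in> seminorm_Cauchy q" for n u v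
    unfolding f_def[of n "u + v"] using tendsto_add[OF f[OF that(1)] f[OF that(2)]]
    by (intro limI) (simp add: g_add)
  have f_scale: "f n (seq_scale sc c u) = c * f n u" if "u \<in> seminorm_Cauchy q" for n c u
    unfolding f_def[of n "seq_scale sc c u"] using tendsto_mult_left[OF f[OF that]]
    by (intro limI) (simp add: seq_scale_def g_scale)
  have f_le: "cmod (f n u) \<le> C n * completion_seminorm q u" if u: "u \<in> seminorm_Cauchy q" for n u
    by (rule LIMSEQ_le[OF tendsto_norm[OF f[OF u]] tendsto_mult_left[OF lim_q[OF u]]])
       (use g_le in blast)
  have yc: "(\<lambda>_. y n) \<in> seminorm_Cauchy p" for n
    by (simp add: seminorm_Cauchy_def seminorm_zero[OF vs p])
  have yn: "completion_seminorm p (\<lambda>_. y n) = p (y n)" for n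
    by (simp add: completion_seminorm_def)
  define S where "S = suminf (\<lambda>n. C n * p (y n))"
  have S: "(\<Sum>n<N. C n * p (y n)) \<le> S" for N
    unfolding S_def using C seminorm_nonneg[OF vs p]
    by (intro sum_le_suminf summable) auto
  have S0: "0 \<le> S" using S[of 0] by simp
  have conv: "(\<lambda>N. completion_seminorm p (u - (\<Sum>n<N. seq_scale sc (f n u) (\<lambda>_. y n)))) \<longlonglongrightarrow> 0"
    if u: "u \<in> seminorm_Cauchy q" for u
  proof (rule LIMSEQ_I)
    fix r :: real assume r: "r > 0"
    \<comment> \<open>Replacing \<open>u\<close> by a nearby \<open>a\<close> will cost 2 * e for
      the vector and 2 * e * S for the coefficients, together r / 2; the other half is left for the
      remainder of the expansion of \<open>a\<close>.\<close>
    define e where "e = r / (4 * (S + 1))"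
    have e: "e > 0" using r S0 by (simp add: e_def)
    have eS: "2 * e * (1 + S) = r / 2" using S0 by (simp add: e_def field_simps)
    obtain K where K: "\<forall>i\<ge>K. \<forall>j\<ge>K. q (u i - u j) < e"
      using u e by (auto simp: seminorm_Cauchy_def)
    obtain a where a: "a \<in> D" "q (u K - a) < e" using dense[OF e] by blast
    have qa: "q (u k - a) \<le> 2 * e" if "k \<ge> K" for k
      using K that a(2) seminorm_diff_triangle[OF vs q, of "u k" a "u K"]
      by (smt (verit) order_refl)
    have fa: "cmod (g n a - f n u) \<le> C n * (2 * e)" for n
    proof (rule LIMSEQ_le_const2)
      show "(\<lambda>k. cmod (g n a - g n (u k))) \<longlonglongrightarrow> cmod (g n a - f n u)"
        by (intro tendsto_intros f u)
      have "cmod (g n a - g n (u k)) \<le> C n * (2 * e)" if "k \<ge> K" for k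
        using g_le[of n "u k - a"] mult_left_mono[OF qa[OF that] C[of n]]
        by (simp add: g_diff norm_minus_commute)
      then show "\<exists>N. \<forall>k\<ge>N. cmod (g n a - g n (u k)) \<le> C n * (2 * e)" by blast
    qed
    have term_le: "p (sc (g n a - f n u) (y n)) \<le> (2 * e) * (C n * p (y n))" for n
      using mult_right_mono[OF fa seminorm_nonneg[OF vs p], of n "y n"]
      by (simp add: seminorm_scale[OF vs p] mult_ac)
    let ?R = "\<lambda>N. p (a - (\<Sum>n<N. sc (g n a) (y n)))"
    let ?v = "\<lambda>N k. u k - (\<Sum>n<N. sc (f n u) (y n))"
    have v: "(u - (\<Sum>n<N. seq_scale sc (f n u) (\<lambda>_. y n))) = ?v N" for N
    proof
      fix k
      have "(\<Sum>n\<in>A. seq_scale sc (f n u) (\<lambda>_. y n)) k = (\<Sum>n\<in>A. sc (f n u) (y n))" for A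
        by (induction A rule: infinite_finite_induct) (simp_all add: seq_scale_def)
      then show "(u - (\<Sum>n<N. seq_scale sc (f n u) (\<lambda>_. y n))) k = ?v N k" by simp
    qed
    have v_le: "p (?v N k) \<le> r / 2 + ?R N" if k: "k \<ge> K" for N k
    proof -
      \<comment> \<open>The summands are the error of approximating \<open>u k\<close> by
        \<open>a\<close>, the remainder at \<open>a\<close>, and the error in the
        coefficients.\<close>
      have "?v N k = (u k - a) + (a - (\<Sum>n<N. sc (g n a) (y n)))
                     + (\<Sum>n<N. sc (g n a - f n u) (y n))"
        by (simp add: scale_left_diff_distrib sum_subtractf)
      then have "p (?v N k) \<le> p (u k - a) + ?R N + p (\<Sum>n<N. sc (g n a - f n u) (y n))"
        using seminorm_triangle[OF vs p] by (smt (verit))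
      also have "p (\<Sum>n<N. sc (g n a - f n u) (y n)) \<le> (\<Sum>n<N. (2 * e) * (C n * p (y n)))"
        by (intro order_trans[OF seminorm_sum_le[OF vs p]] sum_mono term_le)
      also have "\<dots> \<le> 2 * e * S"
        unfolding sum_distrib_left[symmetric] using S e by (intro mult_left_mono) auto
      also have "p (u k - a) \<le> 2 * e" using qa[OF k] le[of "u k - a"] by simp
      finally show ?thesis using eS by (simp add: algebra_simps)
    qed
    have vC: "?v N \<in> seminorm_Cauchy p" for N
      using seminorm_Cauchy_minus_const[OF seminorm_Cauchy_mono[OF le u]] by simp
    \<comment> \<open>The limit in \<open>k\<close> is taken with \<open>N\<close> fixed. As
      \<open>K\<close> and \<open>a\<close> do not depend on \<open>N\<close>, only the remainder at
      \<open>a\<close> still varies with \<open>N\<close>.\<close>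
    have lim_le: "completion_seminorm p (?v N) \<le> r / 2 + ?R N" for N
      by (rule LIMSEQ_le_const2[OF lim_p[OF vC]]) (use v_le in blast)
    have nn: "0 \<le> completion_seminorm p (?v N)" for N
      by (rule LIMSEQ_le_const[OF lim_p[OF vC]]) (use seminorm_nonneg[OF vs p] in blast)
    obtain N0 where N0: "\<forall>N\<ge>N0. norm (?R N - 0) < r / 2"
      using LIMSEQ_D[OF expansion[OF a(1)], of "r / 2"] r by auto
    have "norm (completion_seminorm p (?v N) - 0) < r" if "N \<ge> N0" for N
      using N0 that lim_le[of N] nn[of N] by fastforce
    then show "\<exists>N0. \<forall>N\<ge>N0. norm (completion_seminorm p
        (u - (\<Sum>n<N. seq_scale sc (f n u) (\<lambda>_. y n))) - 0) < r"
      unfolding v by blast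
  qed
  show ?thesis
    unfolding nuclear_map_def
    by (rule exI[of _ f], rule exI[of _ "\<lambda>n _. y n"], rule exI[of _ C])
       (use f_add f_scale f_le C yc summable conv in \<open>auto simp: yn\<close>)
qed


section \<open>Continuous extension from a dense subspace\<close>

text \<open>\<open>H x\<close> is the limit of \<open>h\<close> along the filter generated by the
  \<open>a\<close> with \<open>\<iota> a\<close> near \<open>x\<close>: density makes this filter
  proper, and the uniform bound makes its image Cauchy. Filters replace sequences because
  \<open>'e\<close> need not be first countable.\<close>

lemma dense_extension:
  fixes \<iota> :: "'v::ab_group_add \<Rightarrow> 'e::{topological_group_add, ab_group_add}"
    and h :: "'v \<Rightarrow> 'b::complete_space"
  assumes dense: "closure (range \<iota>) = UNIV"
    and unif: "\<And>e. e > 0 \<Longrightarrow> \<exists>V. open V \<and> 0 \<in> V \<and> (\<forall>a b. \<iota> a - \<iota> b \<in> V \<longrightarrow> dist (h a) (h b) < e)"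
  obtains H where "continuous_on UNIV H" "\<And>a. H (\<iota> a) = h a"
proof -
  define F where "F x = filtercomap \<iota> (nhds x)" for x
  have hit: "\<exists>a. \<iota> a \<in> U" if "open U" "U \<noteq> {}" for U
    using dense that open_Int_closure_eq_empty[of U "range \<iota>"] by blast
  have F_bot: "F x \<noteq> bot" for x
    unfolding F_def by (rule filtercomap_neq_bot) (metis hit empty_iff eventually_nhds)
  have shift: "open {z. z - x \<in> W}" if "open W" for W and x :: 'e
    using open_vimage[OF that, of "\<lambda>z. z - x"] by (simp add: vimage_def continuous_intros)
  \<comment> \<open>\<open>W\<close> is chosen with W - W inside \<open>V\<close>, by continuity of
    subtraction at the origin.\<close>
  have near: "\<exists>W. open W \<and> 0 \<in> W \<and>
      (\<forall>x a b. \<iota> a - x \<in> W \<longrightarrow> \<iota> b - x \<in> W \<longrightarrow> dist (h a) (h b) < e)"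
    if e: "e > 0" for e
  proof -
    obtain V where V: "open V" "0 \<in> V" "\<And>a b. \<iota> a - \<iota> b \<in> V \<Longrightarrow> dist (h a) (h b) < e"
      using unif[OF e] by blast
    have "((\<lambda>z :: 'e \<times> 'e. fst z - snd z) \<longlongrightarrow> 0 - 0) (nhds 0 \<times>\<^sub>F nhds 0)"
      by (intro tendsto_diff filterlim_fst filterlim_snd)
    then have "eventually (\<lambda>z :: 'e \<times> 'e. fst z - snd z \<in> V) (nhds 0 \<times>\<^sub>F nhds 0)"
      using V by (auto dest: topological_tendstoD)
    then obtain P where P: "eventually P (nhds 0)" "\<And>z w. P z \<Longrightarrow> P w \<Longrightarrow> z - w \<in> V"
      unfolding eventually_prod_same by (metis fst_conv snd_conv)
    then obtain W where "open W" "0 \<in> W" "\<And>z. z \<in> W \<Longrightarrow> P z"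
      unfolding eventually_nhds by blast
    moreover have "dist (h a) (h b) < e" if "\<iota> a - x \<in> W" "\<iota> b - x \<in> W" for x a b
      using V(3) P(2)[OF calculation(3)[OF that(1)] calculation(3)[OF that(2)]] by simp
    ultimately show ?thesis by blast
  qed
  have "\<exists>l. (h \<longlongrightarrow> l) (F x)" for x
  proof -
    have "cauchy_filter (filtermap h (F x))"
      unfolding cauchy_filter_metric_filtermap
    proof (intro allI impI)
      fix e :: real assume "e > 0"
      then obtain W where W: "open W" "0 \<in> W"
        "\<And>a b. \<iota> a - x \<in> W \<Longrightarrow> \<iota> b - x \<in> W \<Longrightarrow> dist (h a) (h b) < e"
        using near by meson
      have "eventually (\<lambda>a. \<iota> a - x \<in> W) (F x)"
        unfolding F_def by (rule eventually_filtercomapI)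
          (use W(1,2) shift[OF W(1), of x] in \<open>auto simp: eventually_nhds\<close>)
      then show "\<exists>P. eventually P (F x) \<and> (\<forall>a b. P a \<and> P b \<longrightarrow> dist (h a) (h b) < e)"
        using W(3) by blast
    qed
    then show ?thesis
      unfolding filterlim_def
      by (rule cauchy_filter_complete_converges[OF _ complete_UNIV])
         (simp_all add: filtermap_bot_iff F_bot)
  qed
  then obtain H where H: "(h \<longlongrightarrow> H x) (F x)" for x by metis
  \<comment> \<open>Letting one argument tend to \<open>x\<close> turns < into \<le>.
    \<open>W\<close> is independent of \<open>x\<close>, which allows two points to be compared
    through one common \<open>a\<close>.\<close>
  have key: "\<exists>W. open W \<and> 0 \<in> W \<and> (\<forall>x a. \<iota> a - x \<in> W \<longrightarrow> dist (H x) (h a) \<le> e)"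
    if e: "e > 0" for e
  proof -
    obtain W where W: "open W" "0 \<in> W"
      "\<And>x a b. \<iota> a - x \<in> W \<Longrightarrow> \<iota> b - x \<in> W \<Longrightarrow> dist (h a) (h b) < e"
      using near[OF e] by meson
    have "dist (H x) (h a) \<le> e" if a: "\<iota> a - x \<in> W" for x a
    proof (rule tendsto_upperbound[OF _ _ F_bot])
      show "((\<lambda>b. dist (h b) (h a)) \<longlongrightarrow> dist (H x) (h a)) (F x)"
        by (intro tendsto_intros H)
      have "eventually (\<lambda>b. \<iota> b - x \<in> W) (F x)"
        unfolding F_def by (rule eventually_filtercomapI)
          (use W(1,2) shift[OF W(1), of x] in \<open>auto simp: eventually_nhds\<close>)
      then show "eventually (\<lambda>b. dist (h b) (h a) \<le> e) (F x)"
        by eventually_elim (use W(3) a in \<open>force intro: less_imp_le\<close>)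
    qed
    then show ?thesis using W by blast
  qed
  show thesis
  proof
    show "H (\<iota> a) = h a" for a
    proof -
      have "dist (H (\<iota> a)) (h a) \<le> e" if "e > 0" for e
        using key[OF that] by force
      then show ?thesis by (metis dist_eq_0_iff dist_nz field_le_epsilon add_0 not_less)
    qed
    show "continuous_on UNIV H"
      unfolding continuous_on_def
    proof (intro ballI tendstoI)
      fix x and e :: real assume e: "e > 0"
      obtain W where W: "open W" "0 \<in> W" "\<And>x a. \<iota> a - x \<in> W \<Longrightarrow> dist (H x) (h a) \<le> e / 3"
        using key[of "e / 3"] e by force
      have "dist (H y) (H x) < e" if y: "y - x \<in> W" for y
      proof -
        \<comment> \<open>The intersection is nonempty because it contains \<open>y\<close>.\<close>
        have "\<exists>a. \<iota> a \<in> {z. z - x \<in> W} \<inter> {z. z - y \<in> W}"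
          using y W by (intro hit open_Int shift) auto
        then obtain a where "\<iota> a - x \<in> W" "\<iota> a - y \<in> W" by blast
        then have "dist (H x) (h a) \<le> e / 3" "dist (H y) (h a) \<le> e / 3" using W(3) by auto
        then show ?thesis using e dist_triangle2[of "H y" "H x" "h a"] by linarith
      qed
      moreover have "eventually (\<lambda>y. y - x \<in> W) (at x)"
        unfolding eventually_at_topological using shift[OF W(1), of x] W(2) by auto
      ultimately show "eventually (\<lambda>y. dist (H y) (H x) < e) (at x)"
        by (simp add: eventually_mono)
    qed
  qed
qed

lemma dense_range_induct:
  assumes "closure (range \<iota>) = UNIV" "closed {x. P x}" "\<And>a. P (\<iota> a)"
  shows "P x"
  using closure_minimal[of "range \<iota>" "{x. P x}"] assms by blast


section \<open>The topology of the submultiplicative prenorms\<close>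

text \<open>This makes the family of prenorms directed: the sum dominates both summands, and the
  cross terms of the product are nonnegative.\<close>

lemma submultiplicative_prenorm_add:
  assumes vs: "vector_space sc"
    and p: "submultiplicative_prenorm sc mul p" and q: "submultiplicative_prenorm sc mul q"
  shows "submultiplicative_prenorm sc mul (\<lambda>x. p x + q x)"
proof -
  have sp: "seminorm sc p" "seminorm sc q" using p q by (auto simp: submultiplicative_prenorm_def)
  note nn = seminorm_nonneg[OF vs sp(1)] seminorm_nonneg[OF vs sp(2)]
  have "p (mul x y) + q (mul x y) \<le> (p x + q x) * (p y + q y)" for x y
  proof -
    have "p (mul x y) + q (mul x y) \<le> p x * p y + q x * q y"
      using p q by (intro add_mono) (auto simp: submultiplicative_prenorm_def)
    also have "\<dots> \<le> (p x + q x) * (p y + q y)"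
      using nn by (simp add: algebra_simps)
    finally show ?thesis .
  qed
  moreover have "p (x + y) + q (x + y) \<le> (p x + q x) + (p y + q y)" for x y
    using seminorm_triangle[OF vs sp(1), of x y] seminorm_triangle[OF vs sp(2), of x y] by linarith
  ultimately show ?thesis
    using sp by (simp add: submultiplicative_prenorm_def seminorm_def distrib_left)
qed

text \<open>Scaling up is harmless since c \<le> c * c for c \<ge> 1.\<close>

lemma submultiplicative_prenorm_cmult:
  assumes vs: "vector_space sc" and p: "submultiplicative_prenorm sc mul p" and c: "c \<ge> 1"
  shows "submultiplicative_prenorm sc mul (\<lambda>x. c * p x)"
proof -
  have sp: "seminorm sc p" using p by (auto simp: submultiplicative_prenorm_def)
  note nn = seminorm_nonneg[OF vs sp]
  have "c * p (mul x y) \<le> (c * p x) * (c * p y)" for x y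
  proof -
    have "c * p (mul x y) \<le> c * (p x * p y)"
      using p c by (intro mult_left_mono) (auto simp: submultiplicative_prenorm_def)
    also have "\<dots> \<le> c * (c * (p x * p y))"
      using c nn mult_right_mono[OF c, of "p x * p y"] by (intro mult_left_mono) auto
    finally show ?thesis by (simp add: mult_ac)
  qed
  moreover have "c * p (x + y) \<le> c * p x + c * p y" for x y
    using mult_left_mono[OF seminorm_triangle[OF vs sp, of x y], of c] c by (simp add: distrib_left)
  ultimately show ?thesis
    using sp by (simp add: submultiplicative_prenorm_def seminorm_def mult_ac)
qed

text \<open>The generating balls are only a subbase with arbitrary centres. Sums of prenorms handle
  intersections, and the triangle inequality recentres a ball at \<open>x\<close>, so a single
  prenorm always suffices.\<close>

lemma openin_submultiplicative_prenorm_topology: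
  assumes vs: "vector_space sc"
    and U: "openin (seminorm_topology {p. submultiplicative_prenorm sc mul p}) U" and x: "x \<in> U"
  obtains r e where "submultiplicative_prenorm sc mul r" "e > 0" "{y. r (y - x) < e} \<subseteq> U"
proof -
  let ?sub = "submultiplicative_prenorm sc mul"
  have "generate_topology_on {{x. p (x - a) < e} | p a e. p \<in> {p. ?sub p} \<and> e > 0} U"
    using U unfolding seminorm_topology_def openin_topology_generated_by_iff .
  then have "\<forall>x\<in>U. \<exists>r e. ?sub r \<and> e > 0 \<and> {y. r (y - x) < e} \<subseteq> U"
  proof induction
    case (Int A B)
    show ?case
    proof
      fix x assume "x \<in> A \<inter> B"
      then obtain r e r' e' where r: "?sub r" "e > 0" "{y. r (y - x) < e} \<subseteq> A"
        and r': "?sub r'" "e' > 0" "{y. r' (y - x) < e'} \<subseteq> B"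
        using Int.IH by (metis IntD1 IntD2)
      have "0 \<le> r z" "0 \<le> r' z" for z
        using seminorm_nonneg[OF vs] r(1) r'(1) by (auto simp: submultiplicative_prenorm_def)
      then have "{y. r (y - x) + r' (y - x) < min e e'} \<subseteq> A \<inter> B"
        using r(3) r'(3) by (smt (verit) Int_iff mem_Collect_eq subset_iff)
      then show "\<exists>r e. ?sub r \<and> e > 0 \<and> {y. r (y - x) < e} \<subseteq> A \<inter> B"
        using submultiplicative_prenorm_add[OF vs r(1) r'(1)] r(2) r'(2)
        by (intro exI[of _ "\<lambda>x. r x + r' x"] exI[of _ "min e e'"]) auto
    qed
  next
    case (UN K)
    then show ?case by (meson UnionE Union_upper order_trans)
  next
    case (Basis A)
    then obtain p a e where A: "A = {x. p (x - a) < e}" and p: "?sub p" by blast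
    have sp: "seminorm sc p" using p by (simp add: submultiplicative_prenorm_def)
    show ?case
    proof
      fix x assume x: "x \<in> A"
      have "{y. p (y - x) < e - p (x - a)} \<subseteq> A"
        unfolding A using seminorm_diff_triangle[OF vs sp] by (smt (verit) mem_Collect_eq subsetI)
      then show "\<exists>r e. ?sub r \<and> e > 0 \<and> {y. r (y - x) < e} \<subseteq> A"
        using p x A by (intro exI[of _ p] exI[of _ "e - p (x - a)"]) auto
    qed
  qed simp
  then show thesis using x that by blast
qed


section \<open>Weighted \<open>\<ell>\<^sup>1\<close>-norms on the semigroup algebra\<close>

definition weighted_l1 :: "('s \<Rightarrow> real) \<Rightarrow> ('s \<Rightarrow>\<^sub>0 complex) \<Rightarrow> real" where
  "weighted_l1 w a = (\<Sum>s\<in>Poly_Mapping.keys a. cmod (Poly_Mapping.lookup a s) * w s)"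

lemma weighted_l1_superset:
  assumes "finite A" "Poly_Mapping.keys a \<subseteq> A"
  shows "weighted_l1 w a = (\<Sum>s\<in>A. cmod (Poly_Mapping.lookup a s) * w s)"
  unfolding weighted_l1_def using assms
  by (intro sum.mono_neutral_left) (auto simp: in_keys_iff)

lemma weighted_l1_single: "weighted_l1 w (Poly_Mapping.single s c) = cmod c * w s"
  by (simp add: weighted_l1_def)

lemma seminorm_weighted_l1:
  assumes "\<And>s. 0 \<le> w s"
  shows "seminorm sgalg_scale (weighted_l1 w)"
  unfolding seminorm_def
proof (intro conjI allI)
  fix a b :: "'a \<Rightarrow>\<^sub>0 complex"
  let ?A = "Poly_Mapping.keys a \<union> Poly_Mapping.keys b"
  have "weighted_l1 w (a + b) = (\<Sum>s\<in>?A. cmod (Poly_Mapping.lookup (a + b) s) * w s)"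
    by (intro weighted_l1_superset) (simp_all add: Poly_Mapping.keys_add)
  also have "\<dots> \<le> (\<Sum>s\<in>?A. cmod (Poly_Mapping.lookup a s) * w s
                           + cmod (Poly_Mapping.lookup b s) * w s)"
    using assms unfolding lookup_add distrib_right[symmetric]
    by (intro sum_mono mult_right_mono norm_triangle_ineq)
  also have "\<dots> = weighted_l1 w a + weighted_l1 w b"
    by (simp add: sum.distrib weighted_l1_superset[of ?A])
  finally show "weighted_l1 w (a + b) \<le> weighted_l1 w a + weighted_l1 w b" .
next
  fix c and a :: "'a \<Rightarrow>\<^sub>0 complex"
  have "Poly_Mapping.keys (sgalg_scale c a) \<subseteq> Poly_Mapping.keys a" by (auto simp: in_keys_iff)
  then show "weighted_l1 w (sgalg_scale c a) = cmod c * weighted_l1 w a"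
    by (simp add: weighted_l1_superset[of "Poly_Mapping.keys a"] sum_distrib_left norm_mult mult.assoc)
qed

text \<open>The triangle inequality reduces the claim to products of basis vectors, where it is the
  hypothesis on \<open>w\<close>; the double sum of the bounds then factors.\<close>

lemma submultiplicative_prenorm_weighted_l1:
  assumes nn: "\<And>s. 0 \<le> w s" and w: "\<And>s t. w (s * t) \<le> w s * w t"
  shows "submultiplicative_prenorm sgalg_scale sgalg_mult (weighted_l1 w)"
proof -
  note sn = seminorm_weighted_l1[of w, OF nn]
  note le = seminorm_sum_le[OF vector_space_sgalg_scale sn]
  have "weighted_l1 w (sgalg_mult a b) \<le> weighted_l1 w a * weighted_l1 w b" for a b
  proof -
    have "weighted_l1 w (sgalg_mult a b) \<le>
        (\<Sum>s\<in>Poly_Mapping.keys a. \<Sum>t\<in>Poly_Mapping.keys b. weighted_l1 w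
          (Poly_Mapping.single (s * t) (Poly_Mapping.lookup a s * Poly_Mapping.lookup b t)))"
      unfolding sgalg_mult_def by (rule order_trans[OF le sum_mono[OF le]])
    also have "\<dots> \<le> (\<Sum>s\<in>Poly_Mapping.keys a. \<Sum>t\<in>Poly_Mapping.keys b.
          (cmod (Poly_Mapping.lookup a s) * w s) * (cmod (Poly_Mapping.lookup b t) * w t))"
    proof (intro sum_mono)
      fix s t
      show "weighted_l1 w
          (Poly_Mapping.single (s * t) (Poly_Mapping.lookup a s * Poly_Mapping.lookup b t))
        \<le> (cmod (Poly_Mapping.lookup a s) * w s) * (cmod (Poly_Mapping.lookup b t) * w t)"
        using mult_left_mono[OF w[of s t],
            of "cmod (Poly_Mapping.lookup a s) * cmod (Poly_Mapping.lookup b t)"]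
        by (simp add: weighted_l1_single norm_mult mult_ac)
    qed
    also have "\<dots> = weighted_l1 w a * weighted_l1 w b"
      by (simp add: weighted_l1_def sum_product)
    finally show ?thesis .
  qed
  then show ?thesis using sn by (simp add: submultiplicative_prenorm_def)
qed

lemma sgalg_expand_scale:
  "a = (\<Sum>s\<in>Poly_Mapping.keys a.
          sgalg_scale (Poly_Mapping.lookup a s) (Poly_Mapping.single s 1))"
proof -
  have "sgalg_scale c (Poly_Mapping.single s 1) = Poly_Mapping.single s c" for c and s :: 'a
    by (rule poly_mapping_eqI) (simp add: lookup_single when_def)
  then show ?thesis using sgalg_expand[of a] by simp
qed

text \<open>Triangle inequality on the basis expansion: the weighted norm is the largest seminorm
  with prescribed values on the basis.\<close>

lemma seminorm_le_weighted_l1: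
  assumes "seminorm sgalg_scale r"
  shows "r a \<le> weighted_l1 (\<lambda>s. r (Poly_Mapping.single s 1)) a"
proof -
  have "r a = r (\<Sum>s\<in>Poly_Mapping.keys a.
          sgalg_scale (Poly_Mapping.lookup a s) (Poly_Mapping.single s 1))"
    using sgalg_expand_scale[of a] by simp
  also have "\<dots> \<le> weighted_l1 (\<lambda>s. r (Poly_Mapping.single s 1)) a"
    using seminorm_sum_le[OF vector_space_sgalg_scale assms]
    by (simp add: weighted_l1_def seminorm_scale[OF vector_space_sgalg_scale assms, symmetric])
  finally show ?thesis .
qed

text \<open>For positive \<open>w s\<close> this bounds the coordinate functional at
  \<open>s\<close> by 1 / w s; the product form also covers \<open>w s = 0\<close>.\<close>

lemma cmod_lookup_le_weighted_l1:
  assumes "\<And>s. 0 \<le> w s"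
  shows "cmod (Poly_Mapping.lookup a s) * w s \<le> weighted_l1 w a"
proof (cases "s \<in> Poly_Mapping.keys a")
  case True
  then show ?thesis
    unfolding weighted_l1_def using assms by (intro member_le_sum) auto
next
  case False
  then show ?thesis
    using assms by (auto simp: in_keys_iff weighted_l1_def intro!: sum_nonneg)
qed

section \<open>Nuclearity\<close>

text \<open>Density is used in one variable at a time, so closed sections suffice and no product
  topology enters.\<close>

lemma dense_range_induct2:
  assumes dense: "closure (range \<iota>) = UNIV"
    and "\<And>y. closed {x. P x y}" "\<And>x. closed {y. P x y}" "\<And>a b. P (\<iota> a) (\<iota> b)"
  shows "P x y"
  by (rule dense_range_induct[OF dense, where P = "P x"], fact)
     (rule dense_range_induct[OF dense, where P = "\<lambda>x. P x y" for y], use assms in auto)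

text \<open>The prenorm topology is the pullback along \<open>\<iota>\<close>, so an
  \<open>r\<close>-ball around 0 is the preimage of an open set; this turns the Lipschitz bound into
  the hypothesis of \<open>dense_extension\<close>. Both the seminorm \<open>q\<close> and the
  coordinate functionals of the theorem arise this way.\<close>

lemma arens_michael_envelope_extension:
  fixes scE :: "complex \<Rightarrow> 'e \<Rightarrow> 'e::{uniform_topological_group_add, ab_group_add, t2_space}"
    and h :: "'v::ab_group_add \<Rightarrow> 'b::complete_space"
  assumes vs: "vector_space sc" and env: "arens_michael_envelope sc mul scE \<iota>"
    and r: "submultiplicative_prenorm sc mul r"
    and K: "0 \<le> K" and lip: "\<And>a b. dist (h a) (h b) \<le> K * r (a - b)"
  obtains H where "continuous_on UNIV H" "\<And>a. H (\<iota> a) = h a"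
proof (rule dense_extension)
  let ?T = "seminorm_topology {p. submultiplicative_prenorm sc mul p}"
  have T: "?T = pullback_topology UNIV \<iota> euclidean" and lin: "Vector_Spaces.linear sc scE \<iota>"
    using env by (auto simp: arens_michael_envelope_def hausdorff_completion_def)
  show "closure (range \<iota>) = UNIV"
    using env by (auto simp: arens_michael_envelope_def hausdorff_completion_def)
  interpret lin: Vector_Spaces.linear sc scE \<iota> by fact
  have sr: "seminorm sc r" using r by (simp add: submultiplicative_prenorm_def)
  fix e :: real assume e: "e > 0"
  define d where "d = e / (K + 1)"
  have d: "d > 0" using e K by (simp add: d_def)
  have "openin ?T {x. r (x - 0) < d}"
    unfolding seminorm_topology_def using r d by (intro topology_generated_by_Basis) blast
  then obtain V where V: "open V" "{x. r x < d} = \<iota> -` V"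
    unfolding T openin_pullback_topology by auto
  have "dist (h a) (h b) < e" if "\<iota> a - \<iota> b \<in> V" for a b
  proof -
    have "r (a - b) < d" using V(2) that by (metis lin.diff mem_Collect_eq vimageI)
    have "dist (h a) (h b) \<le> (K + 1) * r (a - b)"
      using lip[of a b] seminorm_nonneg[OF vs sr, of "a - b"] by (simp add: distrib_right)
    also have "\<dots> < (K + 1) * d" using \<open>r (a - b) < d\<close> K by (intro mult_strict_left_mono) auto
    also have "\<dots> = e" using K by (simp add: d_def)
    finally show ?thesis .
  qed
  moreover have "0 \<in> V"
    using V(2) d seminorm_zero[OF vs sr] lin.zero by (metis mem_Collect_eq vimageE)
  ultimately show "\<exists>V. open V \<and> 0 \<in> V \<and> (\<forall>a b. \<iota> a - \<iota> b \<in> V \<longrightarrow> dist (h a) (h b) < e)"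
    using V(1) by blast
qed (rule that)

text \<open>The preimage of the unit ball of \<open>p\<close> contains an \<open>r\<close>-ball of
  radius \<open>e\<close>, so p (\<iota> a) \<le> r a / e by homogeneity. The factor is raised to at
  least 1 so that the multiple of \<open>r\<close> stays submultiplicative.\<close>

lemma arens_michael_envelope_seminorm_le:
  assumes vs: "vector_space sc" and env: "arens_michael_envelope sc mul scE \<iota>"
    and p: "seminorm scE p" "continuous_on UNIV p"
  obtains r where "submultiplicative_prenorm sc mul r" "\<And>a. p (\<iota> a) \<le> r a"
proof -
  let ?T = "seminorm_topology {p. submultiplicative_prenorm sc mul p}"
  have T: "?T = pullback_topology UNIV \<iota> euclidean" and lin: "Vector_Spaces.linear sc scE \<iota>"
    and vsE: "vector_space scE"
    using env by (auto simp: arens_michael_envelope_def hausdorff_completion_def locally_convex_space_def)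
  interpret lin: Vector_Spaces.linear sc scE \<iota> by fact
  have "open {x. p x < 1}" by (intro open_Collect_less p(2) continuous_intros)
  then have "openin ?T {a. p (\<iota> a) < 1}"
    unfolding T openin_pullback_topology by (intro exI[of _ "{x. p x < 1}"]) auto
  moreover have "0 \<in> {a. p (\<iota> a) < 1}"
    by (simp add: lin.zero seminorm_zero[OF vsE p(1)])
  ultimately obtain r e where r: "submultiplicative_prenorm sc mul r" and e: "e > 0"
    and sub: "{y. r (y - 0) < e} \<subseteq> {a. p (\<iota> a) < 1}"
    by (rule openin_submultiplicative_prenorm_topology[OF vs])
  have sr: "seminorm sc r" using r by (simp add: submultiplicative_prenorm_def)
  have bound: "p (\<iota> a) \<le> max 1 (1 / e) * r a" for a
  proof -
    have "p (\<iota> a) * e \<le> r a"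
    proof (rule field_le_epsilon)
      fix d :: real assume d: "d > 0"
      have ra: "0 \<le> r a" by (rule seminorm_nonneg[OF vs sr])
      \<comment> \<open>As \<open>r a\<close> may be 0, the slack \<open>d\<close> enters the
        denominator; scaling \<open>a\<close> by \<open>c\<close> gives it \<open>r\<close>-value e
        * r a / (r a + d) < e.\<close>
      define c where "c = e / (r a + d)"
      have c: "c > 0" using e d ra by (simp add: c_def)
      have "r (sc (of_real c) a) < e"
        using e d ra c by (simp add: seminorm_scale[OF vs sr] norm_of_real del: of_real_divide)
          (simp add: c_def field_simps)
      then have "p (\<iota> (sc (of_real c) a)) < 1" using sub by auto
      then have "c * p (\<iota> a) < 1" using c by (simp add: lin.scale seminorm_scale[OF vsE p(1)])
      then show "p (\<iota> a) * e \<le> r a + d" using d ra by (simp add: c_def field_simps)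
    qed
    then have "p (\<iota> a) \<le> 1 / e * r a" using e by (simp add: field_simps)
    also have "\<dots> \<le> max 1 (1 / e) * r a"
      by (intro mult_right_mono seminorm_nonneg[OF vs sr]) simp
    finally show ?thesis .
  qed
  show thesis
    by (rule that[OF submultiplicative_prenorm_cmult[OF vs r] bound]) simp
qed

section \<open>The dominating seminorm and the nuclear expansion\<close>

theorem theorem2:
  fixes scaleE :: "complex \<Rightarrow> 'e \<Rightarrow> 'e::{uniform_topological_group_add, ab_group_add, t2_space}"
    and \<iota> :: "('s::semigroup_mult \<Rightarrow>\<^sub>0 complex) \<Rightarrow> 'e"
  assumes "countable (UNIV :: 's set)"
    and "arens_michael_envelope sgalg_scale sgalg_mult scaleE \<iota>"
  shows "nuclear_space scaleE"
proof -
  note vs = vector_space_sgalg_scale and env = assms(2)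
  have lcs: "locally_convex_space scaleE" and dense: "closure (range \<iota>) = UNIV"
    and lin: "Vector_Spaces.linear sgalg_scale scaleE \<iota>"
    using env by (auto simp: arens_michael_envelope_def hausdorff_completion_def)
  then have vsE: "vector_space scaleE"
    and contE: "continuous_on UNIV (\<lambda>(c, x). scaleE c x)"
    by (auto simp: locally_convex_space_def)
  interpret E: vector_space scaleE by fact
  interpret lin: Vector_Spaces.linear sgalg_scale scaleE \<iota> by fact
  have cont_scale: "continuous_on UNIV (scaleE c)" for c
    using continuous_on_compose2[OF contE, of UNIV "\<lambda>x. (c, x)"]
    by (simp add: continuous_on_Pair continuous_intros)
  have cont_add: "continuous_on UNIV (\<lambda>x. x + y)" "continuous_on UNIV (\<lambda>x. y + x)"
    "continuous_on UNIV (\<lambda>x. y - x)" for y :: 'e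
    by (intro continuous_intros)+
  obtain \<phi> :: "'s \<Rightarrow> real" where \<phi>1: "\<And>s. 1 \<le> \<phi> s"
    and \<phi>mult: "\<And>s t. \<phi> (s * t) \<le> \<phi> s * \<phi> t"
    and \<phi>sum: "\<And>F. finite F \<Longrightarrow> (\<Sum>s\<in>F. 1 / \<phi> s) \<le> 2"
    by (rule summable_submultiplicative_weight[OF assms(1)]) blast
  obtain e :: "'s \<Rightarrow> nat" where e: "inj e" using assms(1) by (auto simp: countable_def)
  have "\<exists>q. seminorm scaleE q \<and> continuous_on UNIV q \<and> (\<forall>x. p x \<le> q x) \<and>
      nuclear_map (seq_scale scaleE) (seminorm_Cauchy q) (completion_seminorm q)
        (seq_scale scaleE) (seminorm_Cauchy p) (completion_seminorm p) (\<lambda>u. u)"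
    if p: "seminorm scaleE p" "continuous_on UNIV p" for p
  proof -
    obtain r where r: "submultiplicative_prenorm sgalg_scale sgalg_mult r"
      and pr: "\<And>a. p (\<iota> a) \<le> r a"
      using arens_michael_envelope_seminorm_le[OF vs env p] by blast
    have sr: "seminorm sgalg_scale r" using r by (simp add: submultiplicative_prenorm_def)
    define \<delta> :: "'s \<Rightarrow> 's \<Rightarrow>\<^sub>0 complex" where "\<delta> s = Poly_Mapping.single s 1" for s
    define w where "w s = r (\<delta> s) * \<phi> s" for s
    have r0: "0 \<le> r a" for a by (rule seminorm_nonneg[OF vs sr])
    have \<phi>0: "0 < \<phi> s" for s using \<phi>1[of s] by simp
    have w0: "0 \<le> w s" for s unfolding w_def using r0 \<phi>0 by (simp add: less_imp_le)
    have rw: "r (\<delta> s) \<le> w s" for s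
      unfolding w_def using mult_left_mono[OF \<phi>1 r0] by simp
    have rmult: "r (\<delta> (s * t)) \<le> r (\<delta> s) * r (\<delta> t)" for s t
    proof -
      have "\<delta> (s * t) = sgalg_mult (\<delta> s) (\<delta> t)" by (simp add: \<delta>_def sgalg_mult_single)
      then show ?thesis using r by (simp add: submultiplicative_prenorm_def)
    qed
    have wmult: "w (s * t) \<le> w s * w t" for s t
      unfolding w_def using mult_mono[OF rmult \<phi>mult, of s t s t] r0 \<phi>0
      by (simp add: mult_ac less_imp_le)
    let ?nw = "weighted_l1 w"
    have nw: "submultiplicative_prenorm sgalg_scale sgalg_mult ?nw"
      by (rule submultiplicative_prenorm_weighted_l1[OF w0 wmult])
    have snw: "seminorm sgalg_scale ?nw" by (rule seminorm_weighted_l1[OF w0])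
    have rnw: "r a \<le> ?nw a" for a
      using rw by (intro order_trans[OF seminorm_le_weighted_l1[OF sr]])
        (auto simp: weighted_l1_def \<delta>_def intro!: sum_mono mult_left_mono)
    \<comment> \<open>\<open>q\<close> carries the weighted norm over to the envelope; 1 is the
      Lipschitz constant of that norm with respect to itself.\<close>
    obtain q where q: "continuous_on UNIV q" and q\<iota>: "\<And>a. q (\<iota> a) = ?nw a"
      by (rule arens_michael_envelope_extension[OF vs env nw, of 1 ?nw])
         (auto simp: dist_real_def seminorm_abs_diff_le[OF vs snw])
    note qc = continuous_on_compose2[OF q]
    have sq: "seminorm scaleE q"
      unfolding seminorm_def
    proof (intro conjI allI)
      fix x y
      show "q (x + y) \<le> q x + q y"
      proof (rule dense_range_induct2[OF dense, where P = "\<lambda>x y. q (x + y) \<le> q x + q y"])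
        show "closed {x. q (x + y) \<le> q x + q y}" for y
          by (intro closed_Collect_le qc q cont_add continuous_intros) auto
        show "closed {y. q (x + y) \<le> q x + q y}" for x
          by (intro closed_Collect_le qc q cont_add continuous_intros) auto
        show "q (\<iota> a + \<iota> b) \<le> q (\<iota> a) + q (\<iota> b)" for a b
          unfolding lin.add[symmetric] q\<iota> by (rule seminorm_triangle[OF vs snw])
      qed
    next
      fix c x
      show "q (scaleE c x) = cmod c * q x"
      proof (rule dense_range_induct[OF dense, where P = "\<lambda>x. q (scaleE c x) = cmod c * q x"])
        show "closed {x. q (scaleE c x) = cmod c * q x}"
          by (intro closed_Collect_eq qc q cont_scale continuous_intros) auto
        show "q (scaleE c (\<iota> a)) = cmod c * q (\<iota> a)" for a
          unfolding lin.scale[symmetric] q\<iota> by (rule seminorm_scale[OF vs snw])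
      qed
    qed
    have pq: "p x \<le> q x" for x
    proof (rule dense_range_induct[OF dense, where P = "\<lambda>x. p x \<le> q x"])
      show "closed {x. p x \<le> q x}" by (intro closed_Collect_le p(2) q)
      show "p (\<iota> a) \<le> q (\<iota> a)" for a
        unfolding q\<iota> using pr rnw order_trans by blast
    qed
    text \<open>
      If \<open>w s = 0\<close>, then the coefficient functional at \<open>s\<close> need not be continuous and is
      replaced by 0; the junk value \<open>1 / w s = 0\<close> is then the right bound for its norm.
    \<close>
    have "\<exists>G. continuous_on UNIV G \<and>
        (\<forall>a. G (\<iota> a) = (if w s = 0 then 0 else Poly_Mapping.lookup a s))" for s
    proof -
      let ?h = "\<lambda>a. if w s = 0 then 0 else Poly_Mapping.lookup a s"
      have lip: "dist (?h a) (?h b) \<le> 1 / w s * ?nw (a - b)" for a b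
        using cmod_lookup_le_weighted_l1[of w "a - b" s, OF w0] w0[of s]
        by (simp add: dist_norm lookup_minus field_simps)
      have "0 \<le> 1 / w s" using w0 by simp
      then obtain H where "continuous_on UNIV H" "\<And>a. H (\<iota> a) = ?h a"
        by (rule arens_michael_envelope_extension[OF vs env nw _ lip]) (rule that)
      then show ?thesis by blast
    qed
    then obtain G where G: "\<And>s. continuous_on UNIV (G s)"
      and G\<iota>: "\<And>s a. G s (\<iota> a) = (if w s = 0 then 0 else Poly_Mapping.lookup a s)"
      by metis
    note Gc = continuous_on_compose2[OF G]
    have G_add: "G s (x + y) = G s x + G s y" for s x y
    proof (rule dense_range_induct2[OF dense, where P = "\<lambda>x y. G s (x + y) = G s x + G s y"])
      show "closed {x. G s (x + y) = G s x + G s y}" for y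
        by (intro closed_Collect_eq Gc G cont_add continuous_intros) auto
      show "closed {y. G s (x + y) = G s x + G s y}" for x
        by (intro closed_Collect_eq Gc G cont_add continuous_intros) auto
      show "G s (\<iota> a + \<iota> b) = G s (\<iota> a) + G s (\<iota> b)" for a b
        unfolding lin.add[symmetric] G\<iota> by (simp add: lookup_add)
    qed
    have G_scale: "G s (scaleE c x) = c * G s x" for s c x
    proof (rule dense_range_induct[OF dense, where P = "\<lambda>x. G s (scaleE c x) = c * G s x"])
      show "closed {x. G s (scaleE c x) = c * G s x}"
        by (intro closed_Collect_eq Gc G cont_scale continuous_intros) auto
      show "G s (scaleE c (\<iota> a)) = c * G s (\<iota> a)" for a
        unfolding lin.scale[symmetric] G\<iota> by simp
    qed
    have G_le: "cmod (G s x) \<le> 1 / w s * q x" for s x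
    proof (rule dense_range_induct[OF dense, where P = "\<lambda>x. cmod (G s x) \<le> 1 / w s * q x"])
      show "closed {x. cmod (G s x) \<le> 1 / w s * q x}"
        by (intro closed_Collect_le continuous_intros G q)
      show "cmod (G s (\<iota> a)) \<le> 1 / w s * q (\<iota> a)" for a
        unfolding G\<iota> q\<iota> using cmod_lookup_le_weighted_l1[of w a s, OF w0] w0[of s]
        by (simp add: field_simps)
    qed
    \<comment> \<open>\<open>e\<close> need not be surjective: indices outside its range get the
      zero functional and the bound 0, so the junk values of \<open>inv e\<close> there are
      harmless.\<close>
    define g where "g n x = (if n \<in> range e then G (inv e n) x else 0)" for n x
    define y where "y n = \<iota> (\<delta> (inv e n))" for n
    define C where "C n = (if n \<in> range e then 1 / w (inv e n) else 0)" for n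
    have pw: "1 / w s * p (\<iota> (\<delta> s)) \<le> 1 / \<phi> s" for s
    proof -
      have "1 / w s * p (\<iota> (\<delta> s)) \<le> 1 / w s * r (\<delta> s)"
        using w0 by (intro mult_left_mono pr) auto
      \<comment> \<open>Equality holds if \<open>r (\<delta> s)\<close> is nonzero; otherwise
        \<open>w s = 0\<close> and the left side is 0.\<close>
      also have "\<dots> \<le> 1 / \<phi> s" using \<phi>0[of s] by (simp add: w_def)
      finally show ?thesis .
    qed
    have p0: "0 \<le> p x" for x by (rule seminorm_nonneg[OF vsE p(1)])
    have C0: "0 \<le> C n" for n using w0 by (simp add: C_def)
    have "nuclear_map (seq_scale scaleE) (seminorm_Cauchy q) (completion_seminorm q)
        (seq_scale scaleE) (seminorm_Cauchy p) (completion_seminorm p) (\<lambda>u. u)"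
    proof (rule nuclear_map_seminorm_completions[OF vsE p(1) sq pq,
          where D = "range \<iota>" and g = g and C = C and y = y])
      fix x and d :: real assume d: "d > 0"
      have "open {z. q (x - z) < d}"
        by (intro open_Collect_less qc cont_add continuous_intros) auto
      moreover have "x \<in> {z. q (x - z) < d}" using d seminorm_zero[OF vsE sq] by simp
      ultimately show "\<exists>a\<in>range \<iota>. q (x - a) < d"
        using dense closure_iff_nhds_not_empty[of x "range \<iota>"] by blast
    next
      show "g n (x + z) = g n x + g n z" "g n (scaleE c x) = c * g n x" for n x z c
        by (simp_all add: g_def G_add G_scale)
      show "cmod (g n x) \<le> C n * q x" for n x using G_le by (simp add: g_def C_def)
      show "0 \<le> C n" for n by (rule C0)
      show "summable (\<lambda>n. C n * p (y n))"
      proof (rule summableI_nonneg_bounded)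
        show "0 \<le> C n * p (y n)" for n using C0 p0 by simp
        fix N
        \<comment> \<open>Distinct indices in the range of \<open>e\<close> name distinct elements,
          so the partial sum is bounded by a sum of \<open>1 / \<phi> s\<close> over a finite
          set.\<close>
        let ?F = "inv e ` ({..<N} \<inter> range e)"
        have inj: "inj_on (inv e) ({..<N} \<inter> range e)"
          by (rule inj_on_subset[OF inj_on_inv_into[of "range e" e UNIV]]) auto
        have "(\<Sum>n<N. C n * p (y n)) = (\<Sum>n\<in>{..<N} \<inter> range e. C n * p (y n))"
          by (intro sum.mono_neutral_right) (auto simp: C_def)
        also have "\<dots> \<le> (\<Sum>n\<in>{..<N} \<inter> range e. 1 / \<phi> (inv e n))"
          using pw by (intro sum_mono) (auto simp: C_def y_def)
        also have "\<dots> = (\<Sum>s\<in>?F. 1 / \<phi> s)"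
          by (simp add: sum.reindex[OF inj])
        also have "\<dots> \<le> 2" by (rule \<phi>sum) simp
        finally show "(\<Sum>n<N. C n * p (y n)) \<le> 2" .
      qed
      fix x assume "x \<in> range \<iota>"
      then obtain a where a: "x = \<iota> a" by blast
      let ?K = "Poly_Mapping.keys a"
      obtain M where M: "e ` ?K \<subseteq> {..<M}"
        using finite_nat_iff_bounded[of "e ` ?K"] by auto
      \<comment> \<open>Once \<open>N\<close> passes every index of the support, no term of the
        expansion is missing except those with \<open>w s = 0\<close>. For these, p (\<iota>
        (\<delta> s)) \<le> r (\<delta> s) \<le> w s = 0, so \<open>p\<close> does not see the
        difference.\<close>
      have "p (x - (\<Sum>n<N. scaleE (g n x) (y n))) = 0" if N: "N \<ge> M" for N
      proof -
        have "(\<Sum>n<N. scaleE (g n x) (y n)) = (\<Sum>n\<in>e ` ?K. scaleE (g n x) (y n))"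
          using M N e by (intro sum.mono_neutral_right) (auto simp: g_def a G\<iota> in_keys_iff)
        also have "\<dots> = (\<Sum>s\<in>?K. scaleE (G s x) (\<iota> (\<delta> s)))"
          using e by (simp add: sum.reindex[OF inj_on_subset[OF e subset_UNIV]] g_def y_def)
        finally have expand: "(\<Sum>n<N. scaleE (g n x) (y n)) =
            (\<Sum>s\<in>?K. scaleE (G s x) (\<iota> (\<delta> s)))" .
        have "x = (\<Sum>s\<in>?K. scaleE (Poly_Mapping.lookup a s) (\<iota> (\<delta> s)))"
          using arg_cong[OF sgalg_expand_scale[of a], of \<iota>]
          unfolding a lin.sum lin.scale \<delta>_def .
        then have "x - (\<Sum>n<N. scaleE (g n x) (y n)) =
            (\<Sum>s\<in>?K. scaleE (Poly_Mapping.lookup a s - G s x) (\<iota> (\<delta> s)))"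
          unfolding expand E.scale_left_diff_distrib sum_subtractf
          by (rule arg_cong2[where f = minus, OF _ refl])
        then have "p (x - (\<Sum>n<N. scaleE (g n x) (y n))) \<le>
            (\<Sum>s\<in>?K. cmod (Poly_Mapping.lookup a s - G s x) * p (\<iota> (\<delta> s)))"
          using seminorm_sum_le[OF vsE p(1)] by (simp add: seminorm_scale[OF vsE p(1), symmetric])
        also have "\<dots> \<le> 0"
        proof (rule sum_nonpos)
          fix s
          show "cmod (Poly_Mapping.lookup a s - G s x) * p (\<iota> (\<delta> s)) \<le> 0"
          proof (cases "w s = 0")
            case True
            then have "p (\<iota> (\<delta> s)) \<le> 0" using pr[of "\<delta> s"] rw[of s] by simp
            then show ?thesis by (simp add: mult_nonneg_nonpos)
          qed (simp add: a G\<iota>)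
        qed
        finally show ?thesis using p0 by (simp add: order_antisym)
      qed
      then show "(\<lambda>N. p (x - (\<Sum>n<N. scaleE (g n x) (y n)))) \<longlonglongrightarrow> 0"
        by (intro tendsto_eventually) (auto simp: eventually_sequentially)
    qed
    then show ?thesis using sq q pq by blast
  qed
  then show ?thesis using lcs by (auto simp: nuclear_space_def)
qed

end
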